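(* Let $A, B \in \mathbb{R}^{n\times n}$ be symmetric. Suppose there are vectors $u^{(ij)} \in \mathbb{R}^n$ ($i,j\in[n]$) and $v^{(kl)} \in \mathbb{R}^n$ ($k,l\in[n]$) satisfying: 1. $u^{(ij)}_k+u^{(ij)}_l + v^{(kl)}_i+v^{(kl)}_j \leq A_{ij} B_{kl}$ for all $i,j,k,l\in[n]$ such that either ($i \neq j$ and $k \neq l$) or ($i=j$ and $k=l$); 2. $u^{(ij)}_i+u^{(ij)}_j + v^{(ij)}_i+v^{(ij)}_j = A_{ij} B_{ij}$ for all $i,j\in[n]$; 3. $\sum_{i,j\in[n]} \big( u^{(ij)}_{\sigma(i)}+u^{(ij)}_{\sigma(j)} + v^{(ij)}_{\sigma^{-1}(i)}+v^{(ij)}_{\sigma^{-1}(j)}\big) \geq \sum_{i,j\in[n]} A_{ij} B_{ij}$ for all permutations $\sigma$ of $[n]$. Then the tuple $(X,\mathbf{X}) = (I, \mathrm{vec}(I)\, \mathrm{vec}(I)^T)$ is an optimal solution to the semidefinite program $\mathrm{SDP}(A,B)$ defined in the context.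
   Context: $[n]=\{1,\dots,n\}$; $I$ is the $n\times n$ identity; $\mathbf{1}\in\mathbb{R}^n$ is the all-ones vector; $u_k$ denotes the $k$-th coordinate of a vector $u$. Rows and columns of $n^2\times n^2$ matrices are indexed by pairs in $[n]\times[n]$ (lexicographic order), so $(A\otimes B)_{(i,k),(j,l)}=A_{ij}B_{kl}$. For $X\in\mathbb{R}^{n\times n}$, $\mathrm{vec}(X)\in\mathbb{R}^{n^2}$ has entries $\mathrm{vec}(X)_{(i,j)}=X_{ij}$, so $(\mathrm{vec}(X)\mathrm{vec}(X)^T)_{(i,j),(k,l)}=X_{ij}X_{kl}$. $M\succeq 0$ means $M$ is symmetric positive semidefinite; $\ge 0$ for matrices without $\succeq$ is entrywise. $\langle P,Q\rangle=\mathrm{tr}(P^TQ)$. $\mathrm{DS}(n)=\{X\in\mathbb{R}^{n\times n}: X\mathbf{1}=\mathbf{1},\ X^T\mathbf{1}=\mathbf{1},\ X\ge 0\}$. $\mathrm{SDP}(A,B)$: minimize $\langle A\otimes B,\mathbf{X}\rangle$ over $\mathbf{X}\in\mathbb{R}^{n^2\times n^2}$ and $X\in\mathbb{R}^{n\times n}$ subject to (a) $\begin{pmatrix}\mathbf{X} & \mathrm{vec}(X)\\ \mathrm{vec}(X)^T & 1\end{pmatrix}\succeq 0$; (b) $\sum_{i,j}\mathbf{X}_{(i,k),(j,l)}=1$ and $\sum_{i,j}\mathbf{X}_{(k,i),(l,j)}=1$ for all $k,l\in[n]$; (c) $\mathbf{X}_{(i,k),(j,k)}=0$ and $\mathbf{X}_{(k,i),(k,j)}=0$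 for all $k$ and all $i\ne j$; (d) $\mathbf{X}\ge 0$ entrywise; (e) $X\in\mathrm{DS}(n)$. *)

theory Defs
  imports "HOL-Analysis.Analysis"
begin

text \<open>
  The index set \<open>{1, \<dots>, n}\<close> is an arbitrary finite type \<open>'n\<close>. Rows and columns of
  \<open>n\<^sup>2 \<times> n\<^sup>2\<close> matrices are indexed by \<open>'n \<times> 'n\<close>; no order on the indices is needed.
\<close>

type_synonym 'n sqmat = "real ^ 'n ^ 'n"
type_synonym 'n bigmat = "real ^ ('n \<times> 'n) ^ ('n \<times> 'n)"

definition kron :: "('n::finite) sqmat \<Rightarrow> 'n sqmat \<Rightarrow> 'n bigmat" where
  "kron A B = (\<chi> p q. A $ fst p $ fst q * B $ snd p $ snd q)"

text \<open>Not to be confused with the library's \<^const>\<open>vec\<close>, which builds constant vectors.\<close>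

definition vectorize :: "('n::finite) sqmat \<Rightarrow> real ^ ('n \<times> 'n)" where
  "vectorize X = (\<chi> p. X $ fst p $ snd p)"

definition outer :: "real ^ 'm::finite \<Rightarrow> real ^ 'm \<Rightarrow> real ^ 'm ^ 'm" where
  "outer v w = (\<chi> p q. v $ p * w $ q)"

definition mat_inner :: "real ^ 'm::finite ^ 'm \<Rightarrow> real ^ 'm ^ 'm \<Rightarrow> real" where
  "mat_inner P Q = trace (transpose P ** Q)"

definition psd :: "real ^ 'm::finite ^ 'm \<Rightarrow> bool" where
  "psd M \<longleftrightarrow> transpose M = M \<and> (\<forall>x. 0 \<le> x \<bullet> (M *v x))"

definition DS :: "('n::finite) sqmat set" where
  "DS = {X. X *v 1 = 1 \<and> transpose X *v 1 = 1 \<and> (\<forall>i j. 0 \<le> X $ i $ j)}"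

text \<open>
  The block matrix with blocks \<open>M\<close>, \<open>v\<close>, \<open>v\<^sup>T\<close> and \<open>1\<close>. Its index type is a sum, the
  \<^typ>\<open>unit\<close> summand being the index of the last row and column.
\<close>

definition bordered :: "real ^ 'm::finite ^ 'm \<Rightarrow> real ^ 'm \<Rightarrow> real ^ ('m + unit) ^ ('m + unit)" where
  "bordered M v = (\<chi> p q.
     case p of
       Inl a \<Rightarrow> (case q of Inl b \<Rightarrow> M $ a $ b | Inr _ \<Rightarrow> v $ a)
     | Inr _ \<Rightarrow> (case q of Inl b \<Rightarrow> v $ b | Inr _ \<Rightarrow> 1))"

text \<open>Candidate points are pairs \<open>(X, XX)\<close>, with \<open>XX\<close> the \<open>n\<^sup>2 \<times> n\<^sup>2\<close> matrix variable.\<close>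

definition SDP_feasible :: "('n::finite) sqmat \<times> 'n bigmat \<Rightarrow> bool" where
  "SDP_feasible = (\<lambda>(X, XX).
     psd (bordered XX (vectorize X)) \<and>
     (\<forall>k l. (\<Sum>i\<in>UNIV. \<Sum>j\<in>UNIV. XX $ (i, k) $ (j, l)) = 1 \<and>
            (\<Sum>i\<in>UNIV. \<Sum>j\<in>UNIV. XX $ (k, i) $ (l, j)) = 1) \<and>
     (\<forall>k i j. i \<noteq> j \<longrightarrow> XX $ (i, k) $ (j, k) = 0 \<and> XX $ (k, i) $ (k, j) = 0) \<and>
     (\<forall>p q. 0 \<le> XX $ p $ q) \<and>
     X \<in> DS)"

definition SDP_objective :: "('n::finite) sqmat \<Rightarrow> 'n sqmat \<Rightarrow> 'n sqmat \<times> 'n bigmat \<Rightarrow> real" where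
  "SDP_objective A B = (\<lambda>(X, XX). mat_inner (kron A B) XX)"

definition SDP_optimal :: "('n::finite) sqmat \<Rightarrow> 'n sqmat \<Rightarrow> 'n sqmat \<times> 'n bigmat \<Rightarrow> bool" where
  "SDP_optimal A B s \<longleftrightarrow> is_arg_min (SDP_objective A B) SDP_feasible s"

end

theory Submission
  imports Defs
begin

text \<open>
  Weak duality reduces the semidefinite program to an assignment problem, in which the identity
  is optimal by hypothesis.

  Let \<open>(X, XX)\<close> be feasible, and let \<open>w\<close> be the indicator of one row or one column of
  \<open>'n \<times> 'n\<close>. The sum constraints and double stochasticity make the quadratic form of the bordered
  matrix vanish at \<open>(w, -1)\<close>. A positive semidefinite matrix annihilates such a vector, so
  \<open>XX w = vec X\<close> (\<open>feasible_marginals\<close>). In other words, the partial sums of \<open>XX\<close> over a single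
  index are entries of \<open>X\<close>.

  Feasibility forces the entries of \<open>XX\<close> to vanish exactly where \<open>ineq\<close> is not assumed. Multiplying
  \<open>ineq\<close> by the nonnegative entries of \<open>XX\<close> and summing therefore bounds the objective from below
  by a sum in which every coefficient of \<open>XX\<close> depends on only three of the four indices. By the
  marginal identities this sum is a linear function \<open>\<Sum>i k. C i k * X i k\<close> of \<open>X\<close> (\<open>objective_ge_linear\<close>).

  Hypotheses \<open>diag\<close> and \<open>perm\<close> say that the identity is a cheapest assignment for \<open>C\<close>. Then it is
  also at least as cheap as every doubly stochastic matrix (\<open>doubly_stochastic_cost_ge\<close>). This
  would follow from Birkhoff's theorem, but it is obtained here more directly: the entries
  off the diagonal of \<open>X\<close> form a circulation, which decomposes into cycles, and a cycle completed by
  fixed points is a permutation. The identity thus gives the lower bound, and it attains it.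
\<close>

section \<open>Assignment costs of doubly stochastic matrices\<close>

text \<open>
  A minimal nonempty invariant set works, since its image is again invariant. Such a set is a
  cycle of the functional graph of \<open>f\<close>.
\<close>

lemma finite_self_map_permutes_subset:
  assumes "finite V" "V \<noteq> {}" "f ` V \<subseteq> V"
  obtains R where "R \<subseteq> V" "R \<noteq> {}" "f ` R = R" "inj_on f R"
proof -
  let ?P = "\<lambda>R. R \<subseteq> V \<and> R \<noteq> {} \<and> f ` R \<subseteq> R"
  obtain R where R: "?P R" and minimal: "\<And>S. ?P S \<Longrightarrow> card R \<le> card S"
    using arg_min_nat_lemma[of ?P V card] assms by blast
  have "finite R" using R assms(1) finite_subset by blast
  have "?P (f ` R)" using R by blast
  then have "card R \<le> card (f ` R)" by (rule minimal)
  then have "f ` R = R"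
    using R \<open>finite R\<close> by (simp add: card_seteq)
  moreover from this have "inj_on f R"
    using \<open>finite R\<close> by (simp add: eq_card_imp_inj_on)
  ultimately show thesis using that R by blast
qed

text \<open>
  Induction on the number of positive entries off the diagonal. If there is such an entry, choose
  one in every row that has one. Since every row sum equals the corresponding column sum, this
  choice never leaves the set of those rows, so it contains a cycle. Subtracting
  the least entry along this cycle from all its entries leaves a circulation, makes an entry vanish,
  and decreases the total by a nonnegative multiple of the cost of the cycle. As loops are free, this
  cost is that of the permutation which fixes all points off the cycle.
\<close>

lemma circulation_cost_nonneg:
  fixes w Y :: "'n::finite \<Rightarrow> 'n \<Rightarrow> real"
  assumes loops: "\<And>i. w i i = 0"
    and perms: "\<And>\<sigma>. \<sigma> permutes UNIV \<Longrightarrow> 0 \<le> (\<Sum>i\<in>UNIV. w i (\<sigma> i))"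
    and "\<And>i k. 0 \<le> Y i k"
    and "\<And>i. (\<Sum>k\<in>UNIV. Y i k) = (\<Sum>k\<in>UNIV. Y k i)"
  shows "0 \<le> (\<Sum>i\<in>UNIV. \<Sum>k\<in>UNIV. w i k * Y i k)"
  using assms(3,4)
proof (induction "card {(i, k). i \<noteq> k \<and> 0 < Y i k}" arbitrary: Y rule: less_induct)
  case less
  note nonneg = less.prems(1) and balance = less.prems(2)
  define V where "V = {i. \<exists>k. i \<noteq> k \<and> 0 < Y i k}"
  show ?case
  proof (cases "V = {}")
    case True
    then have "Y i k = 0" if "i \<noteq> k" for i k
      using that nonneg[of i k] unfolding V_def by fastforce
    then have "w i k * Y i k = 0" for i k
      using loops by (cases "i = k") auto
    then show ?thesis by (simp only: sum.neutral_const order_refl)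
  next
    case False
    have "\<forall>i\<in>V. \<exists>k. i \<noteq> k \<and> 0 < Y i k" unfolding V_def by blast
    then obtain f where f: "\<And>i. i \<in> V \<Longrightarrow> i \<noteq> f i \<and> 0 < Y i (f i)"
      unfolding bchoice_iff by blast
    have "f ` V \<subseteq> V"
    proof
      fix k assume "k \<in> f ` V"
      then obtain i where i: "i \<noteq> k" "0 < Y i k" using f by auto
      show "k \<in> V"
      proof (rule ccontr)
        assume "k \<notin> V"
        then have "Y k j = 0" if "j \<noteq> k" for j
          using that nonneg[of k j] unfolding V_def by fastforce
        then have "(\<Sum>j\<in>UNIV. Y k j) = Y k k"
          by (subst sum.remove[of _ k]) auto
        moreover have "(\<Sum>j\<in>{k, i}. Y j k) \<le> (\<Sum>j\<in>UNIV. Y j k)"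
          by (rule sum_mono2) (auto simp: nonneg)
        ultimately show False using i balance[of k] by auto
      qed
    qed
    then obtain R where R: "R \<subseteq> V" "R \<noteq> {}" "f ` R = R" "inj_on f R"
      using finite_self_map_permutes_subset[of V f] False by auto
    define \<epsilon> where "\<epsilon> = Min ((\<lambda>i. Y i (f i)) ` R)"
    have "\<epsilon> \<in> (\<lambda>i. Y i (f i)) ` R"
      unfolding \<epsilon>_def using R(2) by (intro Min_in) auto
    then obtain r where r: "r \<in> R" "Y r (f r) = \<epsilon>" by auto
    have le: "\<epsilon> \<le> Y i (f i)" if "i \<in> R" for i
      unfolding \<epsilon>_def using that by (intro Min_le) auto
    have "0 < \<epsilon>" using r R(1) f by force
    define Z where "Z i k = (if i \<in> R \<and> k = f i then \<epsilon> else 0)" for i k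
    define Y' where "Y' i k = Y i k - Z i k" for i k
    have "0 \<le> Y' i k" for i k
      using nonneg le unfolding Y'_def Z_def by auto
    moreover have "(\<Sum>k\<in>UNIV. Y' i k) = (\<Sum>k\<in>UNIV. Y' k i)" for i
    proof -
      have row: "(\<Sum>k\<in>UNIV. Z i k) = (if i \<in> R then \<epsilon> else 0)"
        unfolding Z_def by (cases "i \<in> R") auto
      have "(\<Sum>k\<in>UNIV. Z k i) = (\<Sum>k\<in>R. Z k i)"
        by (rule sum.mono_neutral_right) (auto simp: Z_def)
      also have "\<dots> = (\<Sum>k\<in>R. if i = f k then \<epsilon> else 0)"
        by (rule sum.cong) (auto simp: Z_def)
      also have "\<dots> = (\<Sum>k\<in>f ` R. if i = k then \<epsilon> else 0)"
        by (simp add: sum.reindex[OF R(4)])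
      also have "\<dots> = (if i \<in> R then \<epsilon> else 0)"
        using R(3) by simp
      finally show ?thesis
        using row balance[of i] unfolding Y'_def by (simp add: sum_subtractf)
    qed
    moreover have "card {(i, k). i \<noteq> k \<and> 0 < Y' i k} < card {(i, k). i \<noteq> k \<and> 0 < Y i k}"
    proof (rule psubset_card_mono)
      have "(r, f r) \<in> {(i, k). i \<noteq> k \<and> 0 < Y i k}" using r R(1) f by auto
      moreover have "(r, f r) \<notin> {(i, k). i \<noteq> k \<and> 0 < Y' i k}"
        using r by (auto simp: Y'_def Z_def)
      moreover have "{(i, k). i \<noteq> k \<and> 0 < Y' i k} \<subseteq> {(i, k). i \<noteq> k \<and> 0 < Y i k}"
        using \<open>0 < \<epsilon>\<close> by (auto simp: Y'_def Z_def split: if_splits)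
      ultimately show "{(i, k). i \<noteq> k \<and> 0 < Y' i k} \<subset> {(i, k). i \<noteq> k \<and> 0 < Y i k}"
        by blast
    qed simp
    ultimately have IH: "0 \<le> (\<Sum>i\<in>UNIV. \<Sum>k\<in>UNIV. w i k * Y' i k)"
      using less.hyps by blast
    define \<sigma> where "\<sigma> i = (if i \<in> R then f i else i)" for i
    have "bij_betw \<sigma> R R"
      using R(3,4) by (auto simp: bij_betw_def \<sigma>_def inj_on_def)
    then have "\<sigma> permutes R"
      by (rule bij_imp_permutes) (simp add: \<sigma>_def)
    then have "\<sigma> permutes UNIV" by (rule permutes_subset) simp
    have "(\<Sum>k\<in>UNIV. w i k * Z i k) = \<epsilon> * w i (\<sigma> i)" for i
    proof (cases "i \<in> R")
      case True
      then have "w i k * Z i k = (if k = f i then \<epsilon> * w i k else 0)" for k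
        by (simp add: Z_def)
      then show ?thesis using True by (simp add: \<sigma>_def)
    qed (simp add: Z_def \<sigma>_def loops)
    then have "(\<Sum>i\<in>UNIV. \<Sum>k\<in>UNIV. w i k * Z i k) = \<epsilon> * (\<Sum>i\<in>UNIV. w i (\<sigma> i))"
      by (simp add: sum_distrib_left)
    then have "0 \<le> (\<Sum>i\<in>UNIV. \<Sum>k\<in>UNIV. w i k * Z i k)"
      using perms[OF \<open>\<sigma> permutes UNIV\<close>] \<open>0 < \<epsilon>\<close> by simp
    moreover have "(\<Sum>i\<in>UNIV. \<Sum>k\<in>UNIV. w i k * Y i k)
        = (\<Sum>i\<in>UNIV. \<Sum>k\<in>UNIV. w i k * Y' i k) + (\<Sum>i\<in>UNIV. \<Sum>k\<in>UNIV. w i k * Z i k)"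
      by (simp add: Y'_def right_diff_distrib sum_subtractf)
    ultimately show ?thesis using IH by simp
  qed
qed

lemma DS_row_sum: "X \<in> DS \<Longrightarrow> (\<Sum>k\<in>UNIV. X $ i $ k) = 1"
  by (auto simp: DS_def vec_eq_iff matrix_vector_mult_def)

lemma DS_column_sum: "X \<in> DS \<Longrightarrow> (\<Sum>k\<in>UNIV. X $ k $ i) = 1"
  by (auto simp: DS_def vec_eq_iff matrix_vector_mult_def transpose_def)

text \<open>
  Subtracting the diagonal entry of \<open>C\<close> from each row shifts the cost of all doubly stochastic
  matrices by the same amount, and leaves a cost function without loop costs.
\<close>

lemma doubly_stochastic_cost_ge:
  fixes C :: "'n::finite \<Rightarrow> 'n \<Rightarrow> real"
  assumes perms: "\<And>\<sigma>. \<sigma> permutes UNIV \<Longrightarrow> (\<Sum>i\<in>UNIV. C i i) \<le> (\<Sum>i\<in>UNIV. C i (\<sigma> i))"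
    and X: "X \<in> DS"
  shows "(\<Sum>i\<in>UNIV. C i i) \<le> (\<Sum>i\<in>UNIV. \<Sum>k\<in>UNIV. C i k * X $ i $ k)"
proof -
  have "0 \<le> (\<Sum>i\<in>UNIV. \<Sum>k\<in>UNIV. (C i k - C i i) * X $ i $ k)"
    by (rule circulation_cost_nonneg)
      (use X perms in \<open>auto simp: sum_subtractf DS_row_sum DS_column_sum DS_def\<close>)
  also have "\<dots> = (\<Sum>i\<in>UNIV. \<Sum>k\<in>UNIV. C i k * X $ i $ k) - (\<Sum>i\<in>UNIV. C i i)"
    using DS_row_sum[OF X]
    by (simp add: left_diff_distrib sum_subtractf flip: sum_distrib_left)
  finally show ?thesis by simp
qed

section \<open>Marginals of feasible points\<close>

text \<open>
  At a zero of its quadratic form a positive semidefinite matrix has a minimum of this form,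
  so the gradient \<open>2 M x\<close> vanishes there. The proof moves from \<open>x\<close> along \<open>- M x\<close>.
\<close>

lemma psd_quadratic_form_eq_0_imp_kernel:
  fixes M :: "real ^ 'm::finite ^ 'm"
  assumes psd: "psd M" and zero: "x \<bullet> (M *v x) = 0"
  shows "M *v x = 0"
proof -
  define g where "g = M *v x"
  define b where "b = g \<bullet> (M *v g)"
  have "0 \<le> b" using psd unfolding psd_def b_def by blast
  have sym: "x \<bullet> (M *v g) = g \<bullet> g"
    using psd unfolding g_def psd_def
    by (metis dot_lmul_matrix vector_transpose_matrix)
  have *: "0 \<le> s\<^sup>2 * b - 2 * s * (g \<bullet> g)" for s
  proof -
    have "0 \<le> (x - s *\<^sub>R g) \<bullet> (M *v (x - s *\<^sub>R g))"
      using psd unfolding psd_def by blast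
    also have "M *v (x - s *\<^sub>R g) = g - s *\<^sub>R (M *v g)"
      by (simp add: g_def matrix_vector_mult_diff_distrib matrix_vector_mult_scaleR)
    also have "(x - s *\<^sub>R g) \<bullet> (g - s *\<^sub>R (M *v g)) = s\<^sup>2 * b - 2 * s * (g \<bullet> g)"
      using zero sym
      by (simp add: inner_diff_left inner_diff_right b_def g_def[symmetric]
          power2_eq_square algebra_simps inner_commute)
    finally show ?thesis .
  qed
  have "g \<bullet> g \<le> 0"
  proof (cases "b = 0")
    case True
    then show ?thesis using *[of 1] by simp
  next
    case False
    (* The quadratic in s takes its minimum at s = (g . g) / b. *)
    then have "0 < b" using \<open>0 \<le> b\<close> by simp
    then have "0 \<le> - ((g \<bullet> g)\<^sup>2 / b)"
      using *[of "(g \<bullet> g) / b"] by (simp add: power2_eq_square)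
    then have "(g \<bullet> g)\<^sup>2 \<le> 0" using \<open>0 < b\<close> by (simp add: divide_le_0_iff)
    then show ?thesis by simp
  qed
  then show ?thesis
    by (metis g_def inner_ge_zero inner_eq_zero_iff order_antisym)
qed

lemma sum_UNIV_Plus_unit:
  fixes f :: "'m::finite + unit \<Rightarrow> 'a::comm_monoid_add"
  shows "(\<Sum>p\<in>UNIV. f p) = (\<Sum>a\<in>UNIV. f (Inl a)) + f (Inr ())"
proof -
  have "(\<Sum>p\<in>UNIV. f p) = (\<Sum>p\<in>UNIV <+> UNIV. f p)" by simp
  also have "\<dots> = (\<Sum>a\<in>UNIV. f (Inl a)) + (\<Sum>b\<in>UNIV. f (Inr b))"
    by (subst sum.Plus) (simp_all add: comp_def)
  finally show ?thesis by (simp add: UNIV_unit)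
qed

text \<open>
  With \<open>y = (x, -1)\<close>, the assumptions give \<open>y \<bullet> (bordered M v *v y) = 1 - 2 + 1 = 0\<close>.
\<close>

lemma psd_bordered_imp_mult_eq:
  fixes M :: "real ^ 'm::finite ^ 'm"
  assumes psd: "psd (bordered M v)" and quad: "x \<bullet> (M *v x) = 1" and lin: "v \<bullet> x = 1"
  shows "M *v x = v"
proof -
  define y :: "real ^ ('m + unit)"
    where "y = (\<chi> p. case p of Inl a \<Rightarrow> x $ a | Inr _ \<Rightarrow> - 1)"
  have Inl: "(bordered M v *v y) $ Inl a = (M *v x) $ a - v $ a" for a
    by (simp add: matrix_vector_mult_def sum_UNIV_Plus_unit bordered_def y_def)
  have Inr: "(bordered M v *v y) $ Inr () = 0"
    using lin
    by (simp add: matrix_vector_mult_def sum_UNIV_Plus_unit bordered_def y_def inner_vec_def)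
  have "y \<bullet> (bordered M v *v y) = (\<Sum>a\<in>UNIV. x $ a * ((M *v x) $ a - v $ a))"
    unfolding inner_vec_def[of y] sum_UNIV_Plus_unit Inl Inr by (simp add: y_def)
  also have "\<dots> = x \<bullet> (M *v x) - v \<bullet> x"
    by (simp add: inner_vec_def right_diff_distrib sum_subtractf mult.commute)
  finally have "y \<bullet> (bordered M v *v y) = 0" using quad lin by simp
  then have "bordered M v *v y = 0"
    by (rule psd_quadratic_form_eq_0_imp_kernel[OF psd])
  then show ?thesis
    using Inl by (simp add: vec_eq_iff)
qed

lemma sum_UNIV_prod:
  fixes f :: "'a::finite \<times> 'b::finite \<Rightarrow> 'c::comm_monoid_add"
  shows "(\<Sum>p\<in>UNIV. f p) = (\<Sum>i\<in>UNIV. \<Sum>k\<in>UNIV. f (i, k))"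
  by (simp add: sum.cartesian_product flip: UNIV_Times_UNIV)

lemma feasible_marginals:
  assumes "SDP_feasible (X, XX)"
  shows "(\<Sum>j\<in>UNIV. XX $ (i, k) $ (j, l)) = X $ i $ k"
    and "(\<Sum>l\<in>UNIV. XX $ (i, k) $ (j, l)) = X $ i $ k"
    and "(\<Sum>i\<in>UNIV. XX $ (i, k) $ (j, l)) = X $ j $ l"
    and "(\<Sum>k\<in>UNIV. XX $ (i, k) $ (j, l)) = X $ j $ l"
proof -
  have psd: "psd (bordered XX (vectorize X))" and DS: "X \<in> DS"
    and sums: "\<And>k l. (\<Sum>i\<in>UNIV. \<Sum>j\<in>UNIV. XX $ (i, k) $ (j, l)) = 1"
      "\<And>k l. (\<Sum>i\<in>UNIV. \<Sum>j\<in>UNIV. XX $ (k, i) $ (l, j)) = 1"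
    using assms by (auto simp: SDP_feasible_def)
  have sym: "XX $ p $ q = XX $ q $ p" for p q
  proof -
    have "transpose (bordered XX (vectorize X)) $ Inl p $ Inl q
        = bordered XX (vectorize X) $ Inl p $ Inl q"
      using psd by (simp add: psd_def)
    then show ?thesis by (simp add: transpose_def bordered_def)
  qed
  show fst: "(\<Sum>j\<in>UNIV. XX $ (i, k) $ (j, l)) = X $ i $ k" for i k l
  proof -
    define w :: "real ^ ('a \<times> 'a)" where "w = (\<chi> p. if snd p = l then 1 else 0)"
    have mult: "(XX *v w) $ p = (\<Sum>j\<in>UNIV. XX $ p $ (j, l))" for p
      by (simp add: matrix_vector_mult_def w_def sum_UNIV_prod if_distrib cong: if_cong)
    have dot: "z \<bullet> w = (\<Sum>i\<in>UNIV. z $ (i, l))" for z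
      by (simp add: inner_vec_def w_def sum_UNIV_prod if_distrib cong: if_cong)
    have "XX *v w = vectorize X"
    proof (rule psd_bordered_imp_mult_eq[OF psd])
      show "w \<bullet> (XX *v w) = 1"
        by (simp add: inner_commute[of w] dot mult sums)
      show "vectorize X \<bullet> w = 1"
        by (simp add: dot vectorize_def DS_column_sum[OF DS])
    qed
    then show ?thesis using mult[of "(i, k)"] by (simp add: vectorize_def)
  qed
  show snd: "(\<Sum>l\<in>UNIV. XX $ (i, k) $ (j, l)) = X $ i $ k" for i k j
  proof -
    define w :: "real ^ ('a \<times> 'a)" where "w = (\<chi> p. if fst p = j then 1 else 0)"
    have collapse: "(\<Sum>i\<in>UNIV. \<Sum>l\<in>UNIV. if i = j then g i l else 0) = (\<Sum>l\<in>UNIV. g j l)"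
      for g :: "'a \<Rightarrow> 'a \<Rightarrow> real"
      by (subst sum.swap) simp
    have mult: "(XX *v w) $ p = (\<Sum>l\<in>UNIV. XX $ p $ (j, l))" for p
      by (simp add: matrix_vector_mult_def w_def sum_UNIV_prod if_distrib collapse cong: if_cong)
    have dot: "z \<bullet> w = (\<Sum>l\<in>UNIV. z $ (j, l))" for z
      by (simp add: inner_vec_def w_def sum_UNIV_prod if_distrib collapse cong: if_cong)
    have "XX *v w = vectorize X"
    proof (rule psd_bordered_imp_mult_eq[OF psd])
      show "w \<bullet> (XX *v w) = 1"
        by (simp add: inner_commute[of w] dot mult sums)
      show "vectorize X \<bullet> w = 1"
        by (simp add: dot vectorize_def DS_row_sum[OF DS])
    qed
    then show ?thesis using mult[of "(i, k)"] by (simp add: vectorize_def)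
  qed
  show "(\<Sum>i\<in>UNIV. XX $ (i, k) $ (j, l)) = X $ j $ l"
    using fst[of j l k] by (simp add: sym[of _ "(j, l)"])
  show "(\<Sum>k\<in>UNIV. XX $ (i, k) $ (j, l)) = X $ j $ l"
    using snd[of j l i] by (simp add: sym[of _ "(j, l)"])
qed

section \<open>The dual bound\<close>

lemma SDP_objective_eq:
  "SDP_objective A B (X, XX)
    = (\<Sum>i\<in>UNIV. \<Sum>k\<in>UNIV. \<Sum>j\<in>UNIV. \<Sum>l\<in>UNIV. A $ i $ j * B $ k $ l * XX $ (i, k) $ (j, l))"
proof -
  have "SDP_objective A B (X, XX) = (\<Sum>q\<in>UNIV. \<Sum>p\<in>UNIV. kron A B $ p $ q * XX $ p $ q)"
    by (simp add: SDP_objective_def mat_inner_def trace_def matrix_matrix_mult_def transpose_def)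
  also have "\<dots> = (\<Sum>p\<in>UNIV. \<Sum>q\<in>UNIV. kron A B $ p $ q * XX $ p $ q)"
    by (rule sum.swap)
  finally show ?thesis by (simp add: sum_UNIV_prod kron_def)
qed

text \<open>
  Each of the four terms of \<open>ineq\<close>, such as \<open>u i j $ k\<close>, omits one of the four indices. When it is
  multiplied by \<open>XX $ (i, k) $ (j, l)\<close>, the summation over the omitted index turns \<open>XX\<close> into an entry
  of \<open>X\<close>. The cost of \<open>(i, k)\<close> collects what then multiplies \<open>X $ i $ k\<close>.
\<close>

definition assignment_cost ::
  "('n::finite \<Rightarrow> 'n \<Rightarrow> real ^ 'n) \<Rightarrow> ('n \<Rightarrow> 'n \<Rightarrow> real ^ 'n) \<Rightarrow> 'n \<Rightarrow> 'n \<Rightarrow> real" where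
  "assignment_cost u v i k = (\<Sum>j\<in>UNIV. u i j $ k + u j i $ k + v k j $ i + v j k $ i)"

lemma objective_ge_linear:
  fixes u v :: "'n::finite \<Rightarrow> 'n \<Rightarrow> real ^ 'n"
  assumes ineq: "\<And>i j k l. (i \<noteq> j \<and> k \<noteq> l) \<or> (i = j \<and> k = l) \<Longrightarrow>
        u i j $ k + u i j $ l + v k l $ i + v k l $ j \<le> A $ i $ j * B $ k $ l"
    and feasible: "SDP_feasible (X, XX)"
  shows "(\<Sum>i\<in>UNIV. \<Sum>k\<in>UNIV. assignment_cost u v i k * X $ i $ k) \<le> SDP_objective A B (X, XX)"
proof -
  note marginals = feasible_marginals[OF feasible]
  let ?S = "\<lambda>g. \<Sum>i\<in>UNIV. \<Sum>k\<in>UNIV. \<Sum>j\<in>UNIV. \<Sum>l\<in>UNIV. g i j k l * XX $ (i, k) $ (j, l)"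
  have zero: "i \<noteq> j \<Longrightarrow> XX $ (i, k) $ (j, k) = 0" "i \<noteq> j \<Longrightarrow> XX $ (k, i) $ (k, j) = 0"
    and nonneg: "0 \<le> XX $ p $ q" for i j k p q
    using feasible unfolding SDP_feasible_def by blast+
  have swap: "(\<Sum>i\<in>UNIV. \<Sum>k\<in>UNIV. \<Sum>j\<in>UNIV. \<Sum>l\<in>UNIV. h i k j l)
      = (\<Sum>j\<in>UNIV. \<Sum>l\<in>UNIV. \<Sum>i\<in>UNIV. \<Sum>k\<in>UNIV. h i k j l)"
    for h :: "'n \<Rightarrow> 'n \<Rightarrow> 'n \<Rightarrow> 'n \<Rightarrow> real"
    using sum.swap[of "\<lambda>p q. h (fst p) (snd p) (fst q) (snd q)" UNIV UNIV]
    by (simp add: sum_UNIV_prod)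
  have u1: "?S (\<lambda>i j k l. u i j $ k)
      = (\<Sum>i\<in>UNIV. \<Sum>k\<in>UNIV. (\<Sum>j\<in>UNIV. u i j $ k) * X $ i $ k)"
    by (simp add: marginals sum_distrib_right flip: sum_distrib_left)
  have v1: "?S (\<lambda>i j k l. v k l $ i)
      = (\<Sum>i\<in>UNIV. \<Sum>k\<in>UNIV. (\<Sum>l\<in>UNIV. v k l $ i) * X $ i $ k)"
  proof -
    have "(\<Sum>j\<in>UNIV. \<Sum>l\<in>UNIV. v k l $ i * XX $ (i, k) $ (j, l))
        = (\<Sum>l\<in>UNIV. v k l $ i) * X $ i $ k" for i k
      by (subst sum.swap) (simp add: marginals sum_distrib_right flip: sum_distrib_left)
    then show ?thesis by simp
  qed
  have u2: "?S (\<lambda>i j k l. u i j $ l)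
      = (\<Sum>j\<in>UNIV. \<Sum>l\<in>UNIV. (\<Sum>i\<in>UNIV. u i j $ l) * X $ j $ l)"
    by (subst swap) (simp add: marginals sum_distrib_right flip: sum_distrib_left)
  have v2: "?S (\<lambda>i j k l. v k l $ j)
      = (\<Sum>j\<in>UNIV. \<Sum>l\<in>UNIV. (\<Sum>k\<in>UNIV. v k l $ j) * X $ j $ l)"
  proof -
    have "(\<Sum>i\<in>UNIV. \<Sum>k\<in>UNIV. v k l $ j * XX $ (i, k) $ (j, l))
        = (\<Sum>k\<in>UNIV. v k l $ j) * X $ j $ l" for j l
      by (subst sum.swap) (simp add: marginals sum_distrib_right flip: sum_distrib_left)
    then show ?thesis by (subst swap) simp
  qed
  have "(\<Sum>i\<in>UNIV. \<Sum>k\<in>UNIV. assignment_cost u v i k * X $ i $ k)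
      = ?S (\<lambda>i j k l. u i j $ k) + ?S (\<lambda>i j k l. u i j $ l)
        + ?S (\<lambda>i j k l. v k l $ i) + ?S (\<lambda>i j k l. v k l $ j)"
    unfolding u1 u2 v1 v2
    by (simp add: assignment_cost_def sum.distrib distrib_right)
  also have "\<dots> = ?S (\<lambda>i j k l. u i j $ k + u i j $ l + v k l $ i + v k l $ j)"
    by (simp add: sum.distrib distrib_right)
  also have "\<dots> \<le> ?S (\<lambda>i j k l. A $ i $ j * B $ k $ l)"
  proof (intro sum_mono)
    fix i k j l
    show "(u i j $ k + u i j $ l + v k l $ i + v k l $ j) * XX $ (i, k) $ (j, l)
        \<le> A $ i $ j * B $ k $ l * XX $ (i, k) $ (j, l)"
    proof (cases "(i \<noteq> j \<and> k \<noteq> l) \<or> (i = j \<and> k = l)")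
      case True
      then show ?thesis by (intro mult_right_mono ineq nonneg)
    next
      case False
      then have "XX $ (i, k) $ (j, l) = 0" using zero by auto
      then show ?thesis by simp
    qed
  qed
  finally show ?thesis by (simp add: SDP_objective_eq)
qed

text \<open>
  A term \<open>v (\<sigma> i) j $ i\<close> of the cost becomes \<open>v i j $ inv \<sigma> i\<close> when the sum is reindexed by \<open>\<sigma>\<close>.
\<close>

lemma sum_assignment_cost_permutation:
  fixes u v :: "'n::finite \<Rightarrow> 'n \<Rightarrow> real ^ 'n"
  assumes \<sigma>: "\<sigma> permutes UNIV"
  shows "(\<Sum>i\<in>UNIV. assignment_cost u v i (\<sigma> i))
    = (\<Sum>i\<in>UNIV. \<Sum>j\<in>UNIV. u i j $ \<sigma> i + u i j $ \<sigma> j + v i j $ inv \<sigma> i + v i j $ inv \<sigma> j)"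
proof -
  have reindex: "(\<Sum>i\<in>UNIV. g (\<sigma> i) i) = (\<Sum>i\<in>UNIV. g i (inv \<sigma> i))"
    for g :: "'n \<Rightarrow> 'n \<Rightarrow> real"
    using sum.permute[OF \<sigma>, of "\<lambda>i. g i (inv \<sigma> i)"] \<sigma>
    by (simp add: o_def permutes_inverses)
  have u: "(\<Sum>i\<in>UNIV. \<Sum>j\<in>UNIV. u j i $ \<sigma> i) = (\<Sum>i\<in>UNIV. \<Sum>j\<in>UNIV. u i j $ \<sigma> j)"
    by (rule sum.swap)
  have v: "(\<Sum>i\<in>UNIV. \<Sum>j\<in>UNIV. v (\<sigma> i) j $ i) = (\<Sum>i\<in>UNIV. \<Sum>j\<in>UNIV. v i j $ inv \<sigma> i)"
    by (rule reindex)
  have "(\<Sum>i\<in>UNIV. \<Sum>j\<in>UNIV. v j (\<sigma> i) $ i) = (\<Sum>i\<in>UNIV. \<Sum>j\<in>UNIV. v j i $ inv \<sigma> i)"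
    by (rule reindex)
  also have "\<dots> = (\<Sum>i\<in>UNIV. \<Sum>j\<in>UNIV. v i j $ inv \<sigma> j)"
    by (rule sum.swap)
  finally show ?thesis
    using u v by (simp add: assignment_cost_def sum.distrib)
qed

section \<open>The identity\<close>

lemma psd_outer_self: "psd (outer x x)"
proof -
  have "outer x x *v y = (x \<bullet> y) *\<^sub>R x" for y
    by (simp add: vec_eq_iff outer_def matrix_vector_mult_def inner_vec_def sum_distrib_left
        mult_ac)
  then have "y \<bullet> (outer x x *v y) = (x \<bullet> y)\<^sup>2" for y
    by (simp add: power2_eq_square inner_commute)
  then show ?thesis
    by (simp add: psd_def vec_eq_iff transpose_def outer_def mult.commute)
qed

lemma psd_bordered_outer_self: "psd (bordered (outer x x) x)"
proof -
  define y where "y = (\<chi> p. case p of Inl a \<Rightarrow> x $ a | Inr (_ :: unit) \<Rightarrow> 1)"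
  have "bordered (outer x x) x = outer y y"
    by (simp add: vec_eq_iff bordered_def outer_def y_def split: sum.split)
  then show ?thesis by (simp add: psd_outer_self)
qed

lemma vectorize_mat_1_nth: "vectorize (mat 1) $ (i, k) = (if i = k then 1 else 0)"
  by (simp add: vectorize_def mat_def)

lemma sum_outer_vectorize_mat_1:
  "(\<Sum>j\<in>UNIV. \<Sum>l\<in>UNIV. g j l * outer (vectorize (mat 1)) (vectorize (mat 1)) $ (i, k) $ (j, l))
    = (if i = k then \<Sum>j\<in>UNIV. g j j else 0)"
  by (simp add: outer_def vectorize_mat_1_nth if_distrib cong: if_cong)

lemma identity_feasible:
  "SDP_feasible (mat 1 :: 'n::finite sqmat, outer (vectorize (mat 1)) (vectorize (mat 1)))"
proof -
  have "(mat 1 :: 'n sqmat) \<in> DS"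
    by (simp add: DS_def transpose_mat) (simp add: mat_def)
  moreover have "outer (vectorize (mat 1)) (vectorize (mat 1)) $ (i, k) $ (j, l)
      = (if i = k then if j = l then 1 else 0 else 0)" for i j k l :: 'n
    by (simp add: outer_def vectorize_mat_1_nth)
  moreover have "(\<Sum>i\<in>UNIV. \<Sum>j\<in>UNIV. if i = k then if j = l then 1 else 0 else 0) = (1 :: real)"
    and "(\<Sum>i\<in>UNIV. \<Sum>j\<in>UNIV. if k = i then if l = j then 1 else 0 else 0) = (1 :: real)"
    for k l :: 'n
    by (subst sum.swap, simp)+
  ultimately show ?thesis
    by (auto simp: SDP_feasible_def psd_bordered_outer_self)
qed

lemma identity_objective:
  "SDP_objective A B (mat 1, outer (vectorize (mat 1)) (vectorize (mat 1)))
    = (\<Sum>i\<in>UNIV. \<Sum>j\<in>UNIV. A $ i $ j * B $ i $ j)"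
  by (simp add: SDP_objective_eq sum_outer_vectorize_mat_1)

theorem theorem3p1:
  fixes A B :: "real ^ 'n::finite ^ 'n"
    and u v :: "'n \<Rightarrow> 'n \<Rightarrow> real ^ 'n"
  assumes A_sym: "transpose A = A" and B_sym: "transpose B = B"
    and ineq: "\<And>i j k l. (i \<noteq> j \<and> k \<noteq> l) \<or> (i = j \<and> k = l) \<Longrightarrow>
        u i j $ k + u i j $ l + v k l $ i + v k l $ j \<le> A $ i $ j * B $ k $ l"
    and diag: "\<And>i j. u i j $ i + u i j $ j + v i j $ i + v i j $ j = A $ i $ j * B $ i $ j"
    and perm: "\<And>\<sigma>. \<sigma> permutes (UNIV :: 'n set) \<Longrightarrow>
        (\<Sum>i\<in>UNIV. \<Sum>j\<in>UNIV. u i j $ \<sigma> i + u i j $ \<sigma> j + v i j $ inv \<sigma> i + v i j $ inv \<sigma> j)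
          \<ge> (\<Sum>i\<in>UNIV. \<Sum>j\<in>UNIV. A $ i $ j * B $ i $ j)"
  shows "SDP_optimal A B (mat 1, outer (vectorize (mat 1)) (vectorize (mat 1)))"
proof -
  have trivial: "(\<Sum>i\<in>UNIV. assignment_cost u v i i) = (\<Sum>i\<in>UNIV. \<Sum>j\<in>UNIV. A $ i $ j * B $ i $ j)"
    using sum_assignment_cost_permutation[of id u v] by (simp add: permutes_id diag)
  have "(\<Sum>i\<in>UNIV. \<Sum>j\<in>UNIV. A $ i $ j * B $ i $ j) \<le> SDP_objective A B (X, XX)"
    if feasible: "SDP_feasible (X, XX)" for X XX
  proof -
    have "X \<in> DS" using feasible by (simp add: SDP_feasible_def)
    then have "(\<Sum>i\<in>UNIV. \<Sum>j\<in>UNIV. A $ i $ j * B $ i $ j)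
        \<le> (\<Sum>i\<in>UNIV. \<Sum>k\<in>UNIV. assignment_cost u v i k * X $ i $ k)"
      using doubly_stochastic_cost_ge[of "assignment_cost u v" X] perm
      by (simp add: trivial sum_assignment_cost_permutation)
    also have "\<dots> \<le> SDP_objective A B (X, XX)"
      by (rule objective_ge_linear[OF ineq feasible])
    finally show ?thesis .
  qed
  then show ?thesis
    using identity_feasible
    by (auto simp: SDP_optimal_def is_arg_min_def identity_objective not_less)
qed

end
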